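(* Let $k$, $p$ and $\mu$ be integers with $k\ge 2$, $p\ge 0$ and $\mu\ge 0$. Let $a_1,a_2,\dots,a_k$ be positive integers with $\gcd(a_1,a_2,\dots,a_k)=1$ and $a_1=\min_{1\le i\le k}a_i$, and let $\{m_0^{(p)},m_1^{(p)},\dots,m_{a_1-1}^{(p)}\}$ be the $p$-Apéry set of $\{a_1,\dots,a_k\}$. Then $$ \sum_{\substack{n\in\mathbb N_0\\ d(n)\le p}}n^\mu=\frac{1}{\mu+1}\sum_{\kappa=0}^{\mu}\binom{\mu+1}{\kappa}B_{\kappa}\,a_1^{\kappa-1}\sum_{i=0}^{a_1-1}\bigl(m_i^{(p)}\bigr)^{\mu+1-\kappa}+\frac{B_{\mu+1}}{\mu+1}\bigl(a_1^{\mu+1}-1\bigr), $$ where $B_n$ are the Bernoulli numbers defined by $\frac{x}{e^x-1}=\sum_{n=0}^\infty B_n\frac{x^n}{n!}$ (so $B_1=-\frac12$).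
   Context: $\mathbb N_0$ denotes the set of non-negative integers. For positive integers $a_1,\dots,a_k$ and $n\in\mathbb N_0$, the denumerant is $$d(n)=d(n;a_1,\dots,a_k)=\#\{(x_1,\dots,x_k)\in\mathbb N_0^k : n=x_1a_1+\cdots+x_ka_k\}.$$ For an integer $p\ge 0$ put $S_p=S_p(a_1,\dots,a_k)=\{n\in\mathbb N_0 : d(n)>p\}$. The $p$-Apéry set of $\{a_1,\dots,a_k\}$ is $\{m_0^{(p)},m_1^{(p)},\dots,m_{a_1-1}^{(p)}\}$, where for $0\le i\le a_1-1$ the non-negative integer $m_i^{(p)}$ is uniquely determined by: (1) $m_i^{(p)}\equiv i\pmod{a_1}$; (2) $m_i^{(p)}\in S_p$; (3) $m_i^{(p)}-a_1\notin S_p$. The convention $0^0=1$ is used (relevant for $n=0$, $\mu=0$). *)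

theory Defs
  imports Complex_Main "HOL-Library.FuncSet"
    "HOL-Computational_Algebra.Formal_Power_Series"
begin

(* The generators a_1, ..., a_k are the values of a function a on {1..k}; tuples x in N_0^k are
   the extensional functions on {1..k}.  For positive a_i the counted set is finite, so that
   card is the true number of solutions. *)
definition denumerant :: "nat \<Rightarrow> (nat \<Rightarrow> nat) \<Rightarrow> nat \<Rightarrow> nat" where
  "denumerant k a n =
     card {x \<in> {1..k} \<rightarrow>\<^sub>E (UNIV :: nat set). n = (\<Sum>i = 1..k. x i * a i)}"

definition p_semigroup :: "nat \<Rightarrow> (nat \<Rightarrow> nat) \<Rightarrow> nat \<Rightarrow> nat set" where
  "p_semigroup k a p = {n. denumerant k a n > p}"

(* The subtraction is carried out in the integers: a negative m - a_1 does not belong to S_p,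
   whereas truncated subtraction would yield 0, which may belong to S_p. *)
definition p_apery :: "nat \<Rightarrow> (nat \<Rightarrow> nat) \<Rightarrow> nat \<Rightarrow> nat \<Rightarrow> nat" where
  "p_apery k a p i =
     (THE m. m mod a 1 = i mod a 1 \<and> m \<in> p_semigroup k a p \<and>
             int m - int (a 1) \<notin> int ` p_semigroup k a p)"

(* Coefficients of the exponential generating function x / (exp x - 1); this division of formal
   power series cancels the common factor x of numerator and denominator. *)
definition bernoulli_number :: "nat \<Rightarrow> real" where
  "bernoulli_number n = fact n * fps_nth (fps_X / (fps_exp 1 - 1)) n"

end

theory Submission
  imports Defs "HOL-Number_Theory.Cong"
begin

text \<open>
  Write \<open>b = a 1\<close>. Adding a copy of \<open>a 1\<close> to a representation is injective, so the denumerant is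
  monotone along each residue class modulo \<open>b\<close>; coprimality of the generators makes it unbounded
  there. Hence the numbers \<open>n\<close> with denumerant at most \<open>p\<close> in the class of \<open>i < b\<close> are exactly
  \<open>i, i + b, \<dots>, m\<^sub>i - b\<close>, where \<open>m\<^sub>i\<close> is the Apery element of that class.

  The power sums over these progressions are all read off from one identity between exponential
  generating functions. Put \<open>N = \<Sum>n. exp (n t)\<close>, summed over all those \<open>n\<close>,
  \<open>M = \<Sum>i. exp (m\<^sub>i t)\<close>, \<open>R = \<Sum>i<b. exp (i t)\<close>, and let \<open>T = t / (exp (b t) - 1)\<close> and
  \<open>U = t / (exp t - 1)\<close>. Telescoping gives \<open>N (exp (b t) - 1) = M - R\<close>, and the geometric sum
  \<open>R (exp t - 1) = exp (b t) - 1\<close> gives \<open>T R = U\<close>. Multiplying the first identity by \<open>T\<close> yields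
  \<open>t N = T M - U\<close>. Since \<open>U\<close> generates the Bernoulli numbers and \<open>T(t) = U(b t) / b\<close>, the
  coefficient of \<open>t\<close> to the power \<open>\<mu> + 1\<close> is the claimed formula. The lemma
  \<open>power_sum_below_progression_ends\<close> carries this computation, and \<open>p_apery_cutoff\<close> provides the
  description of the residue classes.
\<close>

section \<open>Bernoulli numbers and power sums over progressions\<close>

lemma bernoulli_egf_mult: "fps_X / (fps_exp 1 - 1) * (fps_exp 1 - 1) = (fps_X :: real fps)"
proof -
  have nz: "fps_exp 1 - 1 \<noteq> (0 :: real fps)"
  proof
    assume "fps_exp 1 - 1 = (0 :: real fps)"
    then have "fps_nth (fps_exp 1 - 1) 1 = (0::real)" by simp
    then show False by simp
  qed
  have "subdegree (fps_exp 1 - 1 :: real fps) = 1"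
    by (rule subdegreeI) auto
  then have "fps_exp 1 - 1 dvd (fps_X :: real fps)"
    using nz by (simp add: fps_dvd_iff)
  then show ?thesis by (rule dvd_div_mult_self)
qed

text \<open>
  Substituting \<open>c t\<close> for \<open>t\<close> turns \<open>t / (exp t - 1)\<close> into \<open>c t / (exp (c t) - 1)\<close>; dividing by
  \<open>c\<close> accounts for the exponent \<open>n - 1\<close> of \<open>c\<close>.
\<close>

lemma scaled_bernoulli_egf_mult:
  fixes c :: real
  assumes "c \<noteq> 0"
  shows "Abs_fps (\<lambda>n. bernoulli_number n * c powi (int n - 1) / fact n) * (fps_exp c - 1) = fps_X"
proof -
  define U where "U = (fps_X / (fps_exp 1 - 1) :: real fps)"
  have scaled: "Abs_fps (\<lambda>n. bernoulli_number n * c powi (int n - 1) / fact n)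
      = fps_const (1 / c) * (U oo (fps_const c * fps_X))"
    unfolding fps_compose_linear
    using assms by (intro fps_ext) (simp add: U_def bernoulli_number_def power_int_diff)
  have "(U oo (fps_const c * fps_X)) * (fps_exp c - 1)
      = (U * (fps_exp 1 - 1)) oo (fps_const c * fps_X)"
    by (simp add: fps_compose_mult_distrib fps_compose_sub_distrib)
  also have "\<dots> = fps_const c * fps_X"
    by (simp add: U_def bernoulli_egf_mult)
  finally have "(U oo (fps_const c * fps_X)) * (fps_exp c - 1) = fps_const c * fps_X" .
  then show ?thesis
    using assms by (simp add: scaled mult.assoc)
qed

lemma sum_fps_exp_progression:
  fixes x c :: real
  shows "(\<Sum>j<q. fps_exp (x + real j * c)) * (fps_exp c - 1) = fps_exp (x + real q * c) - fps_exp x"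
proof -
  have "(\<Sum>j<q. fps_exp (x + real j * c)) * (fps_exp c - 1)
      = (\<Sum>j<q. fps_exp (x + real (Suc j) * c) - fps_exp (x + real j * c))"
    unfolding sum_distrib_right
    by (intro sum.cong) (simp_all add: algebra_simps fps_exp_add_mult)
  also have "\<dots> = fps_exp (x + real q * c) - fps_exp x"
    by (subst sum_lessThan_telescope) simp
  finally show ?thesis .
qed

text \<open>
  This is the identity \<open>t N = T M - U\<close>, for arbitrary cut-off points \<open>i + q i * b\<close> of the residue
  classes.
\<close>

lemma egf_below_progression_ends:
  fixes b :: nat and q :: "nat \<Rightarrow> nat"
  assumes "b > 0"
  defines "B \<equiv> \<lambda>c. Abs_fps (\<lambda>n. bernoulli_number n * c powi (int n - 1) / fact n)"
  shows "fps_X * (\<Sum>i<b. \<Sum>j<q i. fps_exp (real (i + j * b)))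
       = B (real b) * (\<Sum>i<b. fps_exp (real (i + q i * b))) - B 1"
proof -
  define N where "N = (\<Sum>i<b. \<Sum>j<q i. fps_exp (real (i + j * b)))"
  define M where "M = (\<Sum>i<b. fps_exp (real (i + q i * b)))"
  define R where "R = (\<Sum>i<b. fps_exp (real i))"
  have T: "B (real b) * (fps_exp (real b) - 1) = fps_X"
    unfolding B_def using assms(1) by (intro scaled_bernoulli_egf_mult) simp
  have U: "B 1 * (fps_exp 1 - 1) = fps_X"
    unfolding B_def by (intro scaled_bernoulli_egf_mult) simp
  have N: "N * (fps_exp (real b) - 1) = M - R"
    using sum_fps_exp_progression[of "real i" "real b" "q i" for i]
    by (simp add: N_def M_def R_def sum_distrib_right sum_subtractf)
  have R: "R * (fps_exp 1 - 1) = fps_exp (real b) - 1"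
    using sum_fps_exp_progression[of 0 1 b] by (simp add: R_def)
  have "B (real b) * R * (fps_exp 1 - 1) = B 1 * (fps_exp 1 - 1)"
    by (simp add: mult.assoc R T U)
  moreover have "fps_exp 1 - 1 \<noteq> (0 :: real fps)"
    using U by (metis fps_X_neq_zero mult_zero_right)
  ultimately have TR: "B (real b) * R = B 1"
    by simp
  have "fps_X * N = B (real b) * (N * (fps_exp (real b) - 1))"
    by (simp only: T [symmetric] mult.assoc mult.commute [of N])
  also have "\<dots> = B (real b) * M - B 1"
    unfolding N by (simp add: right_diff_distrib TR)
  finally show ?thesis by (simp only: N_def M_def)
qed

text \<open>
  Compare coefficients at \<open>\<mu> + 1\<close> in the preceding identity and multiply by \<open>(\<mu> + 1)!\<close>. In the Cauchy
  product the term \<open>\<kappa> = \<mu> + 1\<close> involves only the zeroth powers, so it equals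
  \<open>bernoulli_number (\<mu> + 1) * b ^ (\<mu> + 1)\<close> for any cut-off points; together with the
  coefficient of \<open>t / (exp t - 1)\<close> it gives the last summand.
\<close>

lemma power_sum_below_progression_ends:
  fixes b \<mu> :: nat and q :: "nat \<Rightarrow> nat"
  assumes "b > 0"
  shows "(\<Sum>i<b. \<Sum>j<q i. real (i + j * b) ^ \<mu>) =
      1 / real (\<mu> + 1) *
        (\<Sum>\<kappa> = 0..\<mu>. real ((\<mu> + 1) choose \<kappa>) * bernoulli_number \<kappa> *
           real b powi (int \<kappa> - 1) *
           (\<Sum>i = 0..<b. real (i + q i * b) ^ (\<mu> + 1 - \<kappa>)))
      + bernoulli_number (\<mu> + 1) / real (\<mu> + 1) * (real b ^ (\<mu> + 1) - 1)"
proof -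
  define P where "P n = (\<Sum>i<b. real (i + q i * b) ^ n)" for n
  define \<beta> where "\<beta> \<kappa> = bernoulli_number \<kappa> * real b powi (int \<kappa> - 1)" for \<kappa>
  have "fps_nth (fps_X * (\<Sum>i<b. \<Sum>j<q i. fps_exp (real (i + j * b)))) (\<mu> + 1)
      = (\<Sum>\<kappa>=0..\<mu>+1. \<beta> \<kappa> / fact \<kappa> * (P (\<mu> + 1 - \<kappa>) / fact (\<mu> + 1 - \<kappa>)))
        - bernoulli_number (\<mu> + 1) / fact (\<mu> + 1)"
    unfolding egf_below_progression_ends[OF assms]
    by (simp add: fps_mult_nth fps_sum_nth P_def \<beta>_def sum_divide_distrib del: of_nat_add of_nat_mult)
  then have coeff: "(\<Sum>i<b. \<Sum>j<q i. real (i + j * b) ^ \<mu>) / fact \<mu>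
      = (\<Sum>\<kappa>=0..\<mu>+1. \<beta> \<kappa> / fact \<kappa> * (P (\<mu> + 1 - \<kappa>) / fact (\<mu> + 1 - \<kappa>)))
        - bernoulli_number (\<mu> + 1) / fact (\<mu> + 1)"
    by (simp add: fps_sum_nth sum_divide_distrib del: of_nat_add of_nat_mult)
  have binom: "fact (\<mu> + 1) * (\<beta> \<kappa> / fact \<kappa> * (P (\<mu> + 1 - \<kappa>) / fact (\<mu> + 1 - \<kappa>)))
      = real ((\<mu> + 1) choose \<kappa>) * \<beta> \<kappa> * P (\<mu> + 1 - \<kappa>)" if "\<kappa> \<le> \<mu> + 1" for \<kappa>
    by (simp only: binomial_fact[OF that]) (simp add: field_simps)
  have P0: "\<beta> (\<mu> + 1) * P 0 = bernoulli_number (\<mu> + 1) * real b ^ (\<mu> + 1)"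
    using assms by (simp add: P_def \<beta>_def)
  have scale: "x = 1 / c * y + u / c * v" if "c * x = y + u * v" "c \<noteq> 0" for c x y u v :: real
    using that by (simp add: field_simps)
  have "real (\<mu> + 1) * (\<Sum>i<b. \<Sum>j<q i. real (i + j * b) ^ \<mu>)
      = fact (\<mu> + 1) * ((\<Sum>i<b. \<Sum>j<q i. real (i + j * b) ^ \<mu>) / fact \<mu>)"
    by simp
  also have "\<dots> = (\<Sum>\<kappa>=0..\<mu>+1. fact (\<mu> + 1) *
          (\<beta> \<kappa> / fact \<kappa> * (P (\<mu> + 1 - \<kappa>) / fact (\<mu> + 1 - \<kappa>)))) - bernoulli_number (\<mu> + 1)"
    unfolding coeff by (simp only: right_diff_distrib sum_distrib_left) simp
  also have "\<dots> = (\<Sum>\<kappa>=0..\<mu>+1. real ((\<mu> + 1) choose \<kappa>) * \<beta> \<kappa> * P (\<mu> + 1 - \<kappa>))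
      - bernoulli_number (\<mu> + 1)"
    by (intro arg_cong2[where f = "(-)"] sum.cong refl binom) simp
  also have "\<dots> = (\<Sum>\<kappa>=0..\<mu>. real ((\<mu> + 1) choose \<kappa>) * \<beta> \<kappa> * P (\<mu> + 1 - \<kappa>))
      + bernoulli_number (\<mu> + 1) * (real b ^ (\<mu> + 1) - 1)"
    using P0 by (simp add: right_diff_distrib)
  finally have "(\<Sum>i<b. \<Sum>j<q i. real (i + j * b) ^ \<mu>)
      = 1 / real (\<mu> + 1) * (\<Sum>\<kappa>=0..\<mu>. real ((\<mu> + 1) choose \<kappa>) * \<beta> \<kappa> * P (\<mu> + 1 - \<kappa>))
        + bernoulli_number (\<mu> + 1) / real (\<mu> + 1) * (real b ^ (\<mu> + 1) - 1)"
    by (rule scale) simp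
  then show ?thesis
    by (simp only: P_def \<beta>_def atLeast0LessThan mult.assoc)
qed

section \<open>The denumerant along residue classes\<close>

lemma finite_representations:
  fixes a :: "nat \<Rightarrow> nat"
  assumes "\<And>i. i \<in> {1..k} \<Longrightarrow> a i > 0"
  shows "finite {x \<in> {1..k} \<rightarrow>\<^sub>E (UNIV :: nat set). n = (\<Sum>i = 1..k. x i * a i)}"
proof (rule finite_subset)
  show "finite ({1..k} \<rightarrow>\<^sub>E {..n})"
    by (intro finite_PiE) auto
  show "{x \<in> {1..k} \<rightarrow>\<^sub>E UNIV. n = (\<Sum>i = 1..k. x i * a i)} \<subseteq> {1..k} \<rightarrow>\<^sub>E {..n}"
  proof
    fix x assume x: "x \<in> {x \<in> {1..k} \<rightarrow>\<^sub>E UNIV. n = (\<Sum>i = 1..k. x i * a i)}"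
    have "x i \<le> n" if i: "i \<in> {1..k}" for i
    proof -
      have "x i \<le> x i * a i" using assms[OF i] by simp
      also have "\<dots> \<le> (\<Sum>i = 1..k. x i * a i)"
        by (rule member_le_sum[OF i]) auto
      finally show ?thesis using x by simp
    qed
    then show "x \<in> {1..k} \<rightarrow>\<^sub>E {..n}" using x by (auto simp: PiE_iff)
  qed
qed

lemma denumerant_add_generator:
  assumes "\<And>i. i \<in> {1..k} \<Longrightarrow> a i > 0" and l: "l \<in> {1..k}"
  shows "denumerant k a n \<le> denumerant k a (n + a l)"
  unfolding denumerant_def
proof (rule card_inj_on_le)
  let ?f = "\<lambda>x. x(l := x l + 1 :: nat)"
  show "inj_on ?f {x \<in> {1..k} \<rightarrow>\<^sub>E UNIV. n = (\<Sum>i = 1..k. x i * a i)}"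
  proof (rule inj_onI)
    fix x y :: "nat \<Rightarrow> nat"
    assume eq: "?f x = ?f y"
    show "x = y"
    proof
      fix i show "x i = y i" using fun_cong[OF eq, of i] by (auto split: if_splits)
    qed
  qed
  have "(\<Sum>i = 1..k. ?f x i * a i) = (\<Sum>i = 1..k. x i * a i) + a l" for x :: "nat \<Rightarrow> nat"
  proof -
    have "(\<Sum>i = 1..k. ?f x i * a i) = (\<Sum>i = 1..k. x i * a i + (if i = l then a l else 0))"
      by (intro sum.cong) auto
    then show ?thesis using l by (simp add: sum.distrib)
  qed
  then show "?f ` {x \<in> {1..k} \<rightarrow>\<^sub>E UNIV. n = (\<Sum>i = 1..k. x i * a i)}
      \<subseteq> {x \<in> {1..k} \<rightarrow>\<^sub>E UNIV. n + a l = (\<Sum>i = 1..k. x i * a i)}"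
    using l by (auto simp: PiE_iff extensional_def)
qed (use finite_representations[of k a "n + a l"] assms(1) in blast)

lemma bezout_finite_set:
  fixes a :: "'a \<Rightarrow> nat"
  assumes "finite I"
  shows "\<exists>z. (\<Sum>i\<in>I. z i * int (a i)) = int (Gcd (a ` I))"
  using assms
proof induction
  case (insert j I)
  then obtain z where z: "(\<Sum>i\<in>I. z i * int (a i)) = int (Gcd (a ` I))" by blast
  obtain u v where uv: "u * int (a j) + v * int (Gcd (a ` I)) = gcd (int (a j)) (int (Gcd (a ` I)))"
    using bezout_int by blast
  have "(\<Sum>i\<in>insert j I. ((\<lambda>i. v * z i)(j := u)) i * int (a i))
      = u * int (a j) + (\<Sum>i\<in>I. ((\<lambda>i. v * z i)(j := u)) i * int (a i))"
    using insert.hyps by simp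
  also have "(\<Sum>i\<in>I. ((\<lambda>i. v * z i)(j := u)) i * int (a i)) = (\<Sum>i\<in>I. v * (z i * int (a i)))"
    using insert.hyps by (intro sum.cong) auto
  also have "u * int (a j) + \<dots> = int (Gcd (a ` insert j I))"
    using uv z by (simp add: sum_distrib_left[symmetric] gcd_int_int_eq)
  finally show ?case by blast
qed simp

text \<open>
  Modulo \<open>b\<close> the coefficients of an integer combination may be replaced by their non-negative
  residues, so Bezout's identity suffices.
\<close>

lemma represented_in_residue_class:
  fixes a :: "'a \<Rightarrow> nat"
  assumes "finite I" and "Gcd (a ` I) = 1" and "b > 0"
  shows "\<exists>x. [(\<Sum>i\<in>I. x i * a i) = r] (mod b)"
proof -
  obtain z where z: "(\<Sum>i\<in>I. z i * int (a i)) = 1"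
    using bezout_finite_set[OF assms(1), of a] assms(2) by auto
  define x where "x i = nat (int r * z i mod int b)" for i
  have "[int (\<Sum>i\<in>I. x i * a i) = (\<Sum>i\<in>I. int r * z i * int (a i))] (mod int b)"
    unfolding of_nat_sum of_nat_mult
    by (intro cong_sum cong_mult cong_refl) (use assms(3) in \<open>simp add: x_def cong_def\<close>)
  also have "(\<Sum>i\<in>I. int r * z i * int (a i)) = int r"
    using z by (simp add: mult.assoc sum_distrib_left[symmetric])
  finally show ?thesis using cong_int_iff by blast
qed

text \<open>
  Once some \<open>c\<close> in the class is represented, \<open>c + p * a 1 * a 2\<close> has at least \<open>p + 1\<close>
  representations: the surplus can be traded between the first two generators, \<open>a 2\<close> copies of
  \<open>a 1\<close> against \<open>a 1\<close> copies of \<open>a 2\<close>.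
\<close>

lemma denumerant_unbounded_in_residue_class:
  assumes k: "k \<ge> 2" and pos: "\<And>i. i \<in> {1..k} \<Longrightarrow> a i > 0" and gcd1: "Gcd (a ` {1..k}) = 1"
  shows "\<exists>n. [n = r] (mod a 1) \<and> denumerant k a n > p"
proof -
  have pos12: "a 1 > 0" "a 2 > 0" using pos k by auto
  obtain x where x: "[(\<Sum>i = 1..k. x i * a i) = r] (mod a 1)"
    using represented_in_residue_class[OF _ gcd1 pos12(1)] by auto
  define n where "n = (\<Sum>i = 1..k. x i * a i) + p * a 1 * a 2"
  define f where "f j = restrict (x(1 := x 1 + (p - j) * a 2, 2 := x 2 + j * a 1)) {1..k}" for j
  have split: "{1..k} = insert 1 (insert 2 {3..k})" using k by auto
  have "(\<Sum>i = 1..k. f j i * a i) = n" if "j \<le> p" for j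
  proof -
    have "(\<Sum>i = 1..k. f j i * a i)
        = (\<Sum>i = 1..k. (x(1 := x 1 + (p - j) * a 2, 2 := x 2 + j * a 1)) i * a i)"
      by (intro sum.cong) (auto simp: f_def)
    also have "\<dots> = (\<Sum>i = 1..k. x i * a i) + ((p - j) + j) * a 1 * a 2"
      unfolding split by (simp add: algebra_simps)
    finally show ?thesis using that by (simp add: n_def)
  qed
  then have "f ` {..p} \<subseteq> {x \<in> {1..k} \<rightarrow>\<^sub>E UNIV. n = (\<Sum>i = 1..k. x i * a i)}"
    by (auto simp: f_def)
  then have "card (f ` {..p}) \<le> denumerant k a n"
    unfolding denumerant_def using finite_representations[of k a n] pos by (intro card_mono) auto
  moreover have "inj_on f {..p}"
  proof (rule inj_onI)
    fix i j assume "f i = f j"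
    then have "f i 2 = f j 2" by simp
    then show "i = j" using k pos12 by (simp add: f_def)
  qed
  ultimately have "denumerant k a n > p" by (simp add: card_image)
  moreover have "[n = r] (mod a 1)"
    using x by (simp add: n_def cong_def mult.assoc mult.left_commute[of p])
  ultimately show ?thesis by blast
qed

section \<open>Apery elements as cut-off points\<close>

text \<open>
  Along \<open>i, i + a 1, i + 2 * a 1, \<dots>\<close> the condition \<open>denumerant > p\<close> persists once it holds, and
  it does hold eventually. So exactly one member satisfies it without its predecessor doing so, namely the
  least one; if that is \<open>i\<close> itself, its predecessor is negative.
\<close>

lemma p_apery_cutoff:
  assumes "k \<ge> 2" and pos: "\<And>i. i \<in> {1..k} \<Longrightarrow> a i > 0" and "Gcd (a ` {1..k}) = 1"
    and i: "i < a 1"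
  shows "\<exists>q. p_apery k a p i = i + q * a 1 \<and> (\<forall>j. denumerant k a (i + j * a 1) \<le> p \<longleftrightarrow> j < q)"
proof -
  define Q where "Q j \<longleftrightarrow> denumerant k a (i + j * a 1) > p" for j
  define q where "q = (LEAST j. Q j)"
  have form: "\<exists>j. n = i + j * a 1" if "n mod a 1 = i" for n
    using that mod_mult_div_eq[of n "a 1"] by (metis mult.commute)
  obtain n where n: "n mod a 1 = i" "denumerant k a n > p"
    using denumerant_unbounded_in_residue_class[OF assms(1-3), of i p] i by (auto simp: cong_def)
  obtain j0 where "n = i + j0 * a 1" using form[OF n(1)] by blast
  then have "Q j0" using n(2) by (simp add: Q_def)
  then have Qq: "Q q" unfolding q_def by (rule LeastI)
  have step: "Q (Suc j)" if "Q j" for j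
    using that denumerant_add_generator[of k a 1 "i + j * a 1"] pos assms(1)
    by (force simp: Q_def algebra_simps)
  have Q_iff: "Q j \<longleftrightarrow> q \<le> j" for j
  proof
    show "q \<le> j" if "Q j" unfolding q_def using that by (rule Least_le)
    show "Q j" if "q \<le> j" using that by (induction rule: dec_induct) (use Qq step in auto)
  qed
  have "p_apery k a p i = i + q * a 1"
    unfolding p_apery_def
  proof (rule the_equality)
    have "int (i + q * a 1) - int (a 1) \<noteq> int n" if "p < denumerant k a n" for n
    proof
      assume eq: "int (i + q * a 1) - int (a 1) = int n"
      then have sum: "i + q * a 1 = n + a 1" by linarith
      then have "n mod a 1 = i" using i by (metis mod_add_self2 mod_less mod_mult_self1)
      then obtain j where j: "n = i + j * a 1" using form by blast
      then have "q * a 1 = Suc j * a 1" using sum by simp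
      then have "q = Suc j" using i by (subst (asm) mult_cancel2) simp
      moreover have "Q j" using that j by (simp add: Q_def)
      ultimately show False using Q_iff by simp
    qed
    then show "(i + q * a 1) mod a 1 = i mod a 1 \<and> i + q * a 1 \<in> p_semigroup k a p \<and>
        int (i + q * a 1) - int (a 1) \<notin> int ` p_semigroup k a p"
      using Qq by (auto simp: p_semigroup_def Q_def)
  next
    fix m
    assume m: "m mod a 1 = i mod a 1 \<and> m \<in> p_semigroup k a p \<and>
        int m - int (a 1) \<notin> int ` p_semigroup k a p"
    then obtain j where j: "m = i + j * a 1" using form i by auto
    have "q \<le> j" using m j Q_iff by (simp add: p_semigroup_def Q_def)
    moreover have "\<not> q < j"
    proof
      assume "q < j"
      then obtain l where l: "j = Suc l" "q \<le> l" by (cases j) auto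
      then have "i + l * a 1 \<in> p_semigroup k a p"
        using Q_iff[of l] by (simp add: p_semigroup_def Q_def)
      moreover have "int m - int (a 1) = int (i + l * a 1)" using j l by (simp add: algebra_simps)
      ultimately show False using m by (metis image_eqI)
    qed
    ultimately show "m = i + q * a 1" using j by simp
  qed
  moreover have "denumerant k a (i + j * a 1) \<le> p \<longleftrightarrow> j < q" for j
    using Q_iff[of j] by (auto simp: Q_def)
  ultimately show ?thesis by blast
qed

theorem theorem1:
  fixes k p \<mu> :: nat and a :: "nat \<Rightarrow> nat"
  assumes "k \<ge> 2"
    and "\<And>i. i \<in> {1..k} \<Longrightarrow> a i > 0"
    and "Gcd (a ` {1..k}) = 1"
    and "a 1 = Min (a ` {1..k})"
  shows "finite {n. denumerant k a n \<le> p} \<and>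
    (\<Sum>n | denumerant k a n \<le> p. real n ^ \<mu>) =
      1 / real (\<mu> + 1) *
        (\<Sum>\<kappa> = 0..\<mu>. real ((\<mu> + 1) choose \<kappa>) * bernoulli_number \<kappa> *
           real (a 1) powi (int \<kappa> - 1) *
           (\<Sum>i = 0..<a 1. real (p_apery k a p i) ^ (\<mu> + 1 - \<kappa>)))
      + bernoulli_number (\<mu> + 1) / real (\<mu> + 1) * (real (a 1) ^ (\<mu> + 1) - 1)"
proof -
  have pos: "a 1 > 0" using assms(1,2) by simp
  \<comment> \<open>For \<open>i < a 1\<close>, the numbers of denumerant at most \<open>p\<close> in the class of \<open>i\<close> are the first
    \<open>q i\<close> ones.\<close>
  obtain q where apery: "\<And>i. i < a 1 \<Longrightarrow> p_apery k a p i = i + q i * a 1"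
    and gaps: "\<And>i j. i < a 1 \<Longrightarrow> denumerant k a (i + j * a 1) \<le> p \<longleftrightarrow> j < q i"
  proof -
    have "\<forall>i\<in>{..<a 1}. \<exists>q. p_apery k a p i = i + q * a 1 \<and>
        (\<forall>j. denumerant k a (i + j * a 1) \<le> p \<longleftrightarrow> j < q)"
      using p_apery_cutoff[OF assms(1-3)] by simp
    from bchoice[OF this] show thesis using that by auto
  qed
  let ?D = "SIGMA i:{..<a 1}. {..<q i}"
  have bij: "bij_betw (\<lambda>(i, j). i + j * a 1) ?D {n. denumerant k a n \<le> p}"
  proof (rule bij_betwI[where g = "\<lambda>n. (n mod a 1, n div a 1)"])
    show "(\<lambda>n. (n mod a 1, n div a 1)) \<in> {n. denumerant k a n \<le> p} \<rightarrow> ?D"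
      using pos gaps[of "n mod a 1" "n div a 1" for n] by auto
  qed (use pos gaps in auto)
  have "finite {n. denumerant k a n \<le> p}"
    using bij_betw_finite[OF bij] by simp
  moreover have "(\<Sum>n | denumerant k a n \<le> p. real n ^ \<mu>)
      = (\<Sum>i<a 1. \<Sum>j<q i. real (i + j * a 1) ^ \<mu>)"
    by (subst sum.reindex_bij_betw[OF bij, symmetric]) (simp add: sum.Sigma case_prod_beta)
  ultimately show ?thesis
    by (simp only: power_sum_below_progression_ends[OF pos]) (simp add: apery)
qed

end
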